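(* Let $(C,Z,\models)$ and $(C,Z',\models')$ be concept-class triples with the same concept class $C$ such that $Z\subseteq Z'$ and, for all $c\in C$ and $z\in Z$, $c\models z$ if and only if $c\models' z$. Let $L$ be a MAP-learner for $(C,Z,\models)$ with parameters $P(c)$ and $P(z|c)$ ($c\in C$, $z\in Z$). Let $L_{\uparrow Z'}$ be the MAP-learner for $(C,Z',\models')$ with priors $P(c)$ and conditional likelihoods $P_{\uparrow Z'}(z'|c)=P(z'|c)$ if $z'\in Z$ and $P_{\uparrow Z'}(z'|c)=0$ if $z'\in Z'\setminus Z$. Then for each sampling mode $(\alpha,\beta)\in\{O,\overline{O}\}\times\{R,\overline{R}\}$, $$\mathrm{MAP\text{-}TD}^{\alpha,\beta}_{L}(C,Z,\models)\ \ge\ \mathrm{MAP\text{-}TD}^{\alpha,\beta}_{L_{\uparrow Z'}}(C,Z',\models').$$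
   Context: A concept-class triple $(C,Z,\models)$ consists of a finite set $C$ with $|C|\ge 2$ (the concept class), a non-empty finite set $Z$ (the observations) and a relation $\models$ on $C\times Z$ (consistency). Sampling modes are pairs $(\alpha,\beta)\in\{O,\overline{O}\}\times\{R,\overline{R}\}$ (ordered/unordered, with/without replacement). $\mathcal{Z}^{O,R}$ is the set of finite sequences over $Z$; $\mathcal{Z}^{\overline{O},R}$ the set of finite multisets over $Z$; $\mathcal{Z}^{O,\overline{R}}$ the set of repetition-free sequences over $Z$; $\mathcal{Z}^{\overline{O},\overline{R}}=2^Z$. The empty sequence/multiset/set is included and denoted $\emptyset$; $|I|$ is the length of a sequence or the cardinality (with multiplicity) of a (multi)set. For a probability vector $Q=(q(z))_{z\in Z}$: $P^{O,R}((z_1,\dots,z_n)|Q)=\prod_{i=1}^n q(z_i)$; for a multiset $A$ of size $n$ with distinct elements $z'_1,\dots,z'_k$ of multiplicities $n_1,\dots,n_k$, $P^{\overline{O},R}(A|Q)=\frac{n!}{n_1!\cdots n_k!}\prod_{i=1}^k q(z'_i)^{n_i}$; for a repetition-free sequence with $n\le|\{z:q(z)>0\}|$, $P^{O,\overline{R}}((z_1,\dots,z_n)|Q)=\prod_{i=1}^n \frac{q(z_i)}{1-(q(z_1)+\dots+q(z_{i-1}))}$; for a set $A=\{z_1,\dots,z_n\}$ of size $n\le|\{z:q(z)>0\}|$, $P^{\overline{O},\overline{R}}(A|Q)=\sum_\sigma P^{O,\overline{R}}((z_{\sigma(1)},\dots,z_{\sigma(n)})|Q)$ over all permutations $\sigma$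 of $\{1,\dots,n\}$. The probability of $\emptyset$ is $1$ in every mode. A MAP-learner $L$ for $(C,Z,\models)$ is given by priors $P(c)>0$ with $\sum_{c\in C}P(c)=1$ and conditional likelihoods $P(z|c)\ge 0$ with $\sum_{z\in Z}P(z|c)=1$ for each $c\in C$, subject to the validity condition: $c\not\models z$ implies $P(z|c)=0$. Write $P^{\alpha,\beta}(I|c)$ for $P^{\alpha,\beta}(I|P(\cdot|c))$ and $N^+(C,L)=\min_{c\in C}|\{z\in Z:P(z|c)>0\}|$. A teacher for $L$ in mode $(\alpha,\beta)$ is a map $T:C\to\mathcal{Z}^{\alpha,\beta}$ such that for every $c_0\in C$: if $\beta=\overline{R}$ then $|T(c_0)|\le N^+(C,L)$; and $c_0$ is the unique maximizer over $c\in C$ of $P(c)\cdot P^{\alpha,\beta}(T(c_0)|c)$. The order of $T$ is $\max_{c\in C}|T(c)|$. $\mathrm{MAP\text{-}TD}^{\alpha,\beta}_L(C,Z,\models)$ is the smallest order of a teacher for $L$ in mode $(\alpha,\beta)$, or $\infty$ if no teacher exists. *)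

theory Defs
  imports Complex_Main "HOL-Library.Extended_Nat" "HOL-Library.Multiset" "HOL-Library.FuncSet"
    "HOL-Combinatorics.Multiset_Permutations"
begin

definition concept_class_triple :: "'c set \<Rightarrow> 'z set \<Rightarrow> ('c \<Rightarrow> 'z \<Rightarrow> bool) \<Rightarrow> bool" where
  "concept_class_triple C Z models \<longleftrightarrow> finite C \<and> card C \<ge> 2 \<and> finite Z \<and> Z \<noteq> {}"
  \<comment> \<open>Only the values of \<open>models\<close> on \<open>C \<times> Z\<close> are ever used, so no condition is imposed on it.\<close>

datatype order_mode = Ordered | Unordered
datatype repl_mode = Repl | NoRepl

text \<open>One type holds the samples of all four modes; \<open>sample_space\<close> fixes the constructor
  that belongs to each mode.\<close>

datatype 'z sample = Sequence "'z list" | Multi "'z multiset" | Subset "'z set"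

fun sample_space :: "order_mode \<Rightarrow> repl_mode \<Rightarrow> 'z set \<Rightarrow> 'z sample set" where
  "sample_space Ordered Repl Z = Sequence ` lists Z"
| "sample_space Unordered Repl Z = Multi ` {A. set_mset A \<subseteq> Z}"
| "sample_space Ordered NoRepl Z = Sequence ` {zs \<in> lists Z. distinct zs}"
| "sample_space Unordered NoRepl Z = Subset ` Pow Z"

fun sample_size :: "'z sample \<Rightarrow> nat" where
  "sample_size (Sequence zs) = length zs"
| "sample_size (Multi A) = size A"
| "sample_size (Subset A) = card A"

definition seq_prob_repl :: "('z \<Rightarrow> real) \<Rightarrow> 'z list \<Rightarrow> real" where
  "seq_prob_repl q zs = (\<Prod>i<length zs. q (zs ! i))"

definition mset_prob_repl :: "('z \<Rightarrow> real) \<Rightarrow> 'z multiset \<Rightarrow> real" where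
  "mset_prob_repl q A =
     fact (size A) / (\<Prod>z\<in>set_mset A. fact (count A z)) * (\<Prod>z\<in>set_mset A. q z ^ count A z)"

text \<open>The two probabilities without replacement are meant only for samples whose size is at
  most the size of the support of \<open>q\<close>: then no denominator vanishes. In \<open>is_teacher\<close> this
  is ensured by the bound \<open>N_plus\<close>.\<close>

definition seq_prob_norepl :: "('z \<Rightarrow> real) \<Rightarrow> 'z list \<Rightarrow> real" where
  "seq_prob_norepl q zs = (\<Prod>i<length zs. q (zs ! i) / (1 - (\<Sum>j<i. q (zs ! j))))"

text \<open>As \<open>\<sigma>\<close> ranges over the permutations of \<open>{1..n}\<close>, the rearrangements of
  \<open>A = {z\<^sub>1, \<dots>, z\<^sub>n}\<close> range, once each, over \<open>permutations_of_set A\<close>.\<close>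

definition set_prob_norepl :: "('z \<Rightarrow> real) \<Rightarrow> 'z set \<Rightarrow> real" where
  "set_prob_norepl q A = (\<Sum>zs\<in>permutations_of_set A. seq_prob_norepl q zs)"

text \<open>Unspecified if the constructor of the sample does not belong to the mode.\<close>

fun sample_prob :: "order_mode \<Rightarrow> repl_mode \<Rightarrow> ('z \<Rightarrow> real) \<Rightarrow> 'z sample \<Rightarrow> real" where
  "sample_prob Ordered Repl q (Sequence zs) = seq_prob_repl q zs"
| "sample_prob Unordered Repl q (Multi A) = mset_prob_repl q A"
| "sample_prob Ordered NoRepl q (Sequence zs) = seq_prob_norepl q zs"
| "sample_prob Unordered NoRepl q (Subset A) = set_prob_norepl q A"

text \<open>\<open>likelihood L c z\<close> is \<open>P(z|c)\<close>, so \<open>likelihood L c\<close> is the probability vector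
  \<open>P(\<cdot>|c)\<close>.\<close>

record ('c, 'z) learner =
  prior :: "'c \<Rightarrow> real"
  likelihood :: "'c \<Rightarrow> 'z \<Rightarrow> real"

definition is_MAP_learner ::
    "'c set \<Rightarrow> 'z set \<Rightarrow> ('c \<Rightarrow> 'z \<Rightarrow> bool) \<Rightarrow> ('c, 'z) learner \<Rightarrow> bool" where
  "is_MAP_learner C Z models L \<longleftrightarrow>
     (\<forall>c\<in>C. prior L c > 0) \<and> (\<Sum>c\<in>C. prior L c) = 1 \<and>
     (\<forall>c\<in>C. \<forall>z\<in>Z. likelihood L c z \<ge> 0) \<and> (\<forall>c\<in>C. (\<Sum>z\<in>Z. likelihood L c z) = 1) \<and>
     (\<forall>c\<in>C. \<forall>z\<in>Z. \<not> models c z \<longrightarrow> likelihood L c z = 0)"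

definition N_plus :: "'c set \<Rightarrow> 'z set \<Rightarrow> ('c, 'z) learner \<Rightarrow> nat" where
  "N_plus C Z L = Min ((\<lambda>c. card {z\<in>Z. likelihood L c z > 0}) ` C)"

text \<open>The set of maximizers over \<open>C\<close> being \<open>{c0}\<close> says that \<open>c0\<close> is the unique maximizer.\<close>

definition is_teacher ::
    "order_mode \<Rightarrow> repl_mode \<Rightarrow> 'c set \<Rightarrow> 'z set \<Rightarrow> ('c, 'z) learner \<Rightarrow> ('c \<Rightarrow> 'z sample) \<Rightarrow> bool"
  where
  "is_teacher \<alpha> \<beta> C Z L T \<longleftrightarrow>
     T \<in> C \<rightarrow> sample_space \<alpha> \<beta> Z \<and>
     (\<forall>c0\<in>C. (\<beta> = NoRepl \<longrightarrow> sample_size (T c0) \<le> N_plus C Z L) \<and>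
        {c. is_arg_max (\<lambda>c. prior L c * sample_prob \<alpha> \<beta> (likelihood L c) (T c0))
              (\<lambda>c. c \<in> C) c} = {c0})"

definition teacher_order :: "'c set \<Rightarrow> ('c \<Rightarrow> 'z sample) \<Rightarrow> nat" where
  "teacher_order C T = Max ((\<lambda>c. sample_size (T c)) ` C)"

text \<open>In \<open>enat\<close> the infimum of a non-empty set is its least element and that of the empty
  set is \<open>\<infinity>\<close>. The consistency relation is not an argument because it enters only through
  the validity condition on \<open>L\<close>.\<close>

definition MAP_TD ::
    "order_mode \<Rightarrow> repl_mode \<Rightarrow> 'c set \<Rightarrow> 'z set \<Rightarrow> ('c, 'z) learner \<Rightarrow> enat" where
  "MAP_TD \<alpha> \<beta> C Z L = (INF T\<in>{T. is_teacher \<alpha> \<beta> C Z L T}. enat (teacher_order C T))"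

text \<open>\<open>extend_learner Z L\<close> is the learner \<open>L\<close> lifted from \<open>Z\<close> to any larger observation set.\<close>

definition extend_learner :: "'z set \<Rightarrow> ('c, 'z) learner \<Rightarrow> ('c, 'z) learner" where
  "extend_learner Z L =
     \<lparr>prior = prior L, likelihood = (\<lambda>c z. if z \<in> Z then likelihood L c z else 0)\<rparr>"

lemma is_MAP_learner_extend_learner:
  assumes "concept_class_triple C Z' models'" and "Z \<subseteq> Z'"
    and "\<forall>c\<in>C. \<forall>z\<in>Z. models c z \<longleftrightarrow> models' c z" and "is_MAP_learner C Z models L"
  shows "is_MAP_learner C Z' models' (extend_learner Z L)"
proof -
  have "finite Z'" using assms(1) by (simp add: concept_class_triple_def)
  then have "(\<Sum>z\<in>Z'. if z \<in> Z then likelihood L c z else 0) = (\<Sum>z\<in>Z. likelihood L c z)" for c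
    using assms(2) by (simp add: sum.inter_restrict[symmetric] Int_absorb1)
  then show ?thesis
    using assms by (auto simp: is_MAP_learner_def extend_learner_def)
qed

end

theory Submission imports Defs begin

text \<open>Samples over \<open>Z\<close> only involve observations in \<open>Z\<close>, where both learners have the same
  likelihoods, and the new observations do not enlarge any support. Hence every teacher for
  \<open>L\<close> is also a teacher for the extended learner.\<close>

lemma seq_prob_repl_cong:
  assumes "\<And>z. z \<in> set zs \<Longrightarrow> q z = q' z"
  shows "seq_prob_repl q zs = seq_prob_repl q' zs"
  unfolding seq_prob_repl_def using assms by (intro prod.cong) auto

lemma mset_prob_repl_cong:
  assumes "\<And>z. z \<in># A \<Longrightarrow> q z = q' z"
  shows "mset_prob_repl q A = mset_prob_repl q' A"
  unfolding mset_prob_repl_def using assms by simp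

text \<open>The partial sums in the denominators run over earlier entries of the same list, so
  \<open>q\<close> is evaluated only at entries of \<open>zs\<close>. The factors agree one by one,
  even where a denominator is 0.\<close>

lemma seq_prob_norepl_cong:
  assumes "\<And>z. z \<in> set zs \<Longrightarrow> q z = q' z"
  shows "seq_prob_norepl q zs = seq_prob_norepl q' zs"
  unfolding seq_prob_norepl_def using assms
  by (intro prod.cong arg_cong2[of _ _ _ _ "(/)"] arg_cong2[of _ _ _ _ "(-)"] sum.cong) auto

lemma set_prob_norepl_cong:
  assumes "\<And>z. z \<in> A \<Longrightarrow> q z = q' z"
  shows "set_prob_norepl q A = set_prob_norepl q' A"
  unfolding set_prob_norepl_def using assms
  by (intro sum.cong seq_prob_norepl_cong) (auto dest: permutations_of_setD)

text \<open>Membership in \<open>sample_space\<close> does two things: it puts all entries of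
  \<open>I\<close> in \<open>Z\<close>, and it fixes the constructor of \<open>I\<close>, which
  excludes the unspecified cases of \<open>sample_prob\<close>.\<close>

lemma sample_prob_cong:
  assumes "I \<in> sample_space \<alpha> \<beta> Z" and "\<And>z. z \<in> Z \<Longrightarrow> q z = q' z"
  shows "sample_prob \<alpha> \<beta> q I = sample_prob \<alpha> \<beta> q' I"
  using assms
  by (cases \<alpha>; cases \<beta>)
    (fastforce intro!: seq_prob_repl_cong mset_prob_repl_cong 
        seq_prob_norepl_cong set_prob_norepl_cong)+

lemma sample_space_mono: "Z \<subseteq> Z' \<Longrightarrow> sample_space \<alpha> \<beta> Z \<subseteq> sample_space \<alpha> \<beta> Z'"
  by (cases \<alpha>; cases \<beta>) auto

text \<open>Carries the size bound of the modes with \<open>NoRepl\<close> over to the extended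
  learner: an observation outside \<open>Z\<close> has likelihood 0 and is never counted.\<close>

lemma N_plus_extend_learner:
  assumes "Z \<subseteq> Z'"
  shows "N_plus C Z' (extend_learner Z L) = N_plus C Z L"
proof -
  have "{z\<in>Z'. likelihood (extend_learner Z L) c z > 0} = {z\<in>Z. likelihood L c z > 0}" for c
    using assms by (auto simp: extend_learner_def)
  then show ?thesis by (simp add: N_plus_def)
qed

lemma is_teacher_extend_learner:
  assumes "Z \<subseteq> Z'" and "is_teacher \<alpha> \<beta> C Z L T"
  shows "is_teacher \<alpha> \<beta> C Z' (extend_learner Z L) T"
proof -
  have T: "T \<in> C \<rightarrow> sample_space \<alpha> \<beta> Z"
    using assms(2) by (simp add: is_teacher_def)
  \<comment> \<open>Here \<open>c\<close> is arbitrary, so the equation can rewrite the objective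
    under the binder in \<open>is_arg_max\<close>.\<close>
  have "sample_prob \<alpha> \<beta> (likelihood (extend_learner Z L) c) (T c0)
      = sample_prob \<alpha> \<beta> (likelihood L c) (T c0)" if "c0 \<in> C" for c c0
    using T that by (intro sample_prob_cong[of _ _ _ Z]) (auto simp: extend_learner_def)
  moreover have "prior (extend_learner Z L) = prior L"
    by (simp add: extend_learner_def)
  moreover have "T \<in> C \<rightarrow> sample_space \<alpha> \<beta> Z'"
    using T sample_space_mono[OF assms(1)] by blast
  ultimately show ?thesis
    using assms by (simp add: is_teacher_def N_plus_extend_learner)
qed

theorem lemma3p8:
  fixes C :: "'c set" and Z Z' :: "'z set"
    and models models' :: "'c \<Rightarrow> 'z \<Rightarrow> bool"
    and L :: "('c, 'z) learner"
    and \<alpha> :: order_mode and \<beta> :: repl_mode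
  assumes "concept_class_triple C Z models"
    and "concept_class_triple C Z' models'"
    and "Z \<subseteq> Z'"
    and "\<forall>c\<in>C. \<forall>z\<in>Z. models c z \<longleftrightarrow> models' c z"
    and "is_MAP_learner C Z models L"
  shows "MAP_TD \<alpha> \<beta> C Z L \<ge> MAP_TD \<alpha> \<beta> C Z' (extend_learner Z L)"
  unfolding MAP_TD_def
  \<comment> \<open>\<open>teacher_order\<close> depends only on \<open>C\<close> and
    \<open>T\<close>, so the same values are minimized over a larger set of teachers. If
    \<open>L\<close> has no teacher, its side is \<infinity>.\<close>
  using is_teacher_extend_learner[OF assms(3)] by (intro INF_superset_mono) auto

end
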